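(* Let $n,m$ be positive integers and let $v=(v_p)_{p\in\mathbb{R}^m}\in\mathcal{S}(\mathbb{R}^m,\mathcal{S}_n')$ be a Schwartz family of tempered distributions, with associated linear operator $\widehat{v}:\mathcal{S}_n\to\mathcal{S}_m$, $\widehat{v}(\phi)(p)=v_p(\phi)$. Then the following assertions all hold, and they are equivalent: 1) the family $v$ is summable with respect to every tempered distribution $a\in\mathcal{S}_m'$; 2) the operator $\widehat{v}$ is (topologically) transposable; 3) the operator $\widehat{v}$ is weakly continuous, i.e. continuous from $\mathcal{S}_n$ to $\mathcal{S}_m$ with respect to the pair of weak topologies $(\sigma(\mathcal{S}_n,\mathcal{S}_n'),\sigma(\mathcal{S}_m,\mathcal{S}_m'))$; 4) the operator $\widehat{v}$ is continuous from $\mathcal{S}_n$ to $\mathcal{S}_m$ with respect to their natural (Fréchet) topologies.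
   Context: $\mathbb{K}$ denotes $\mathbb{R}$ or $\mathbb{C}$. $\mathcal{S}_n$ is the Schwartz space of $\mathbb{K}$-valued rapidly decreasing smooth functions on $\mathbb{R}^n$ with its natural Fréchet topology, and $\mathcal{S}_n'$ is its topological dual, the space of tempered distributions on $\mathbb{R}^n$. A family of tempered distributions indexed by $\mathbb{R}^m$ is a map $v:\mathbb{R}^m\to\mathcal{S}_n'$, $p\mapsto v_p$. For $\phi\in\mathcal{S}_n$, its image under $v$ is the function $v(\phi):\mathbb{R}^m\to\mathbb{K}$, $v(\phi)(p):=v_p(\phi)$. The family $v$ is called a Schwartz family (or $^{\mathcal{S}}$family) if $v(\phi)\in\mathcal{S}_m$ for every $\phi\in\mathcal{S}_n$. The set of all Schwartz families indexed by $\mathbb{R}^m$ in $\mathcal{S}_n'$ is denoted $\mathcal{S}(\mathbb{R}^m,\mathcal{S}_n')$. The operator generated by a Schwartz family $v$ is the linear map $\widehat{v}:\mathcal{S}_n\to\mathcal{S}_m$, $\phi\mapsto v(\phi)$. A Schwartz family $v$ is summable with respect to a linear functional $a$ on $\mathcal{S}_m$ if the linear functional $a\circ\widehat{v}:\mathcal{S}_n\to\mathbb{K}$, $\phi\mapsto a(\widehat{v}(\phi))$, is a tempered distribution (belongs to $\mathcal{S}_n'$). A linear operator $A:\mathcal{S}_n\to\mathcal{S}_m$ is (topologically) transposable if its algebraic transpose ${}^*A:\mathcal{S}_m^*\to\mathcal{S}_n^*$, ${}^*A(a)=a\circ A$ (where $X^*$ denotes the algebraic dual of $X$), maps $\mathcal{S}_m'$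 into $\mathcal{S}_n'$. *)

theory Defs
  imports "HOL-Analysis.Analysis"
begin

text \<open>
  The scalar field is a type \<open>'k\<close> of sort \<open>{real_normed_field, euclidean_space}\<close>. Both \<open>real\<close> and
  \<open>complex\<close> have this sort and, up to isometric isomorphism, they are the only such fields
  (commutative finite-dimensional real normed division algebras).
\<close>

section \<open>The Schwartz space\<close>

definition partial_deriv :: "'n::finite \<Rightarrow> (real^'n \<Rightarrow> 'k::real_normed_vector) \<Rightarrow> real^'n \<Rightarrow> 'k" where
  "partial_deriv i f x = vector_derivative (\<lambda>t. f (x + t *\<^sub>R axis i 1)) (at 0)"

text \<open>
  The index type carries no canonical order, so a partial derivative of higher order is given by
  the list of its directions instead of a multi-index. On smooth functions the order of the list
  is irrelevant and every multi-index is represented.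
\<close>

definition iter_partial_deriv ::
  "'n::finite list \<Rightarrow> (real^'n \<Rightarrow> 'k::real_normed_vector) \<Rightarrow> real^'n \<Rightarrow> 'k" where
  "iter_partial_deriv is f = foldr partial_deriv is f"

text \<open>
  Differentiability is total (Frechet) differentiability, so all iterated partial derivatives are
  automatically continuous.
\<close>

definition smooth :: "(real^'n::finite \<Rightarrow> 'k::real_normed_vector) \<Rightarrow> bool" where
  "smooth f \<longleftrightarrow> (\<forall>is x. iter_partial_deriv is f differentiable (at x))"

definition schwartz_space :: "(real^'n::finite \<Rightarrow> 'k::{real_normed_field,euclidean_space}) set" where
  "schwartz_space = {f. smooth f \<and>
     (\<forall>k is. bdd_above (range (\<lambda>x. (1 + norm x) ^ k * norm (iter_partial_deriv is f x))))}"

text \<open>Outside of \<open>schwartz_space\<close> the supremum may be a junk value.\<close>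

definition schwartz_seminorm ::
  "nat \<Rightarrow> 'n::finite list \<Rightarrow> (real^'n \<Rightarrow> 'k::{real_normed_field,euclidean_space}) \<Rightarrow> real" where
  "schwartz_seminorm k is f = (SUP x. (1 + norm x) ^ k * norm (iter_partial_deriv is f x))"

definition schwartz_topology ::
  "(real^'n::finite \<Rightarrow> 'k::{real_normed_field,euclidean_space}) topology" where
  "schwartz_topology = topology_generated_by
     {{f \<in> schwartz_space. schwartz_seminorm k is (\<lambda>x. f x - g x) < r} | k is g r.
        g \<in> schwartz_space \<and> 0 < r}"


section \<open>Functionals, tempered distributions and operators\<close>

text \<open>
  Functionals on the Schwartz space are represented by functions on the full function type; only
  their values on \<open>schwartz_space\<close> matter.
\<close>

definition schwartz_algebraic_dual ::
  "((real^'n::finite \<Rightarrow> 'k::{real_normed_field,euclidean_space}) \<Rightarrow> 'k) set" where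
  "schwartz_algebraic_dual = {a.
     (\<forall>f\<in>schwartz_space. \<forall>g\<in>schwartz_space. a (\<lambda>x. f x + g x) = a f + a g) \<and>
     (\<forall>c. \<forall>f\<in>schwartz_space. a (\<lambda>x. c * f x) = c * a f)}"

definition tempered_distributions ::
  "((real^'n::finite \<Rightarrow> 'k::{real_normed_field,euclidean_space}) \<Rightarrow> 'k) set" where
  "tempered_distributions =
     {a \<in> schwartz_algebraic_dual. continuous_map schwartz_topology euclidean a}"

definition schwartz_linear_operator ::
  "((real^'n::finite \<Rightarrow> 'k) \<Rightarrow> (real^'m::finite \<Rightarrow> 'k::{real_normed_field,euclidean_space})) \<Rightarrow> bool" where
  "schwartz_linear_operator A \<longleftrightarrow>
     A ` schwartz_space \<subseteq> schwartz_space \<and>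
     (\<forall>f\<in>schwartz_space. \<forall>g\<in>schwartz_space. A (\<lambda>x. f x + g x) = (\<lambda>y. A f y + A g y)) \<and>
     (\<forall>c. \<forall>f\<in>schwartz_space. A (\<lambda>x. c * f x) = (\<lambda>y. c * A f y))"

definition algebraic_transpose ::
  "((real^'n::finite \<Rightarrow> 'k) \<Rightarrow> (real^'m::finite \<Rightarrow> 'k::{real_normed_field,euclidean_space})) \<Rightarrow>
   ((real^'m \<Rightarrow> 'k) \<Rightarrow> 'k) \<Rightarrow> ((real^'n \<Rightarrow> 'k) \<Rightarrow> 'k)" where
  "algebraic_transpose A a = a \<circ> A"

definition transposable ::
  "((real^'n::finite \<Rightarrow> 'k) \<Rightarrow> (real^'m::finite \<Rightarrow> 'k::{real_normed_field,euclidean_space})) \<Rightarrow> bool" where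
  "transposable A \<longleftrightarrow> schwartz_linear_operator A \<and>
     algebraic_transpose A ` tempered_distributions \<subseteq> tempered_distributions"

text \<open>The weak topology \<open>\<sigma>(E, F)\<close>, for a set \<open>F\<close> of functionals on \<open>E\<close>.\<close>

definition weak_topology :: "'e set \<Rightarrow> ('e \<Rightarrow> 'k::topological_space) set \<Rightarrow> 'e topology" where
  "weak_topology E F = topology_generated_by {{f \<in> E. a f \<in> U} | a U. a \<in> F \<and> open U}"

abbreviation schwartz_weak_topology ::
  "(real^'n::finite \<Rightarrow> 'k::{real_normed_field,euclidean_space}) topology" where
  "schwartz_weak_topology \<equiv>
     weak_topology schwartz_space (tempered_distributions :: ((real^'n \<Rightarrow> 'k) \<Rightarrow> 'k) set)"


section \<open>Schwartz families\<close>

definition family_operator ::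
  "(real^'m::finite \<Rightarrow> (real^'n::finite \<Rightarrow> 'k) \<Rightarrow> 'k) \<Rightarrow>
   (real^'n \<Rightarrow> 'k) \<Rightarrow> (real^'m \<Rightarrow> 'k::{real_normed_field,euclidean_space})" where
  "family_operator v \<phi> = (\<lambda>p. v p \<phi>)"

definition schwartz_family ::
  "(real^'m::finite \<Rightarrow> (real^'n::finite \<Rightarrow> 'k::{real_normed_field,euclidean_space}) \<Rightarrow> 'k) \<Rightarrow> bool" where
  "schwartz_family v \<longleftrightarrow>
     (\<forall>p. v p \<in> tempered_distributions) \<and>
     (\<forall>\<phi>\<in>schwartz_space. family_operator v \<phi> \<in> schwartz_space)"

definition summable_wrt ::
  "(real^'m::finite \<Rightarrow> (real^'n::finite \<Rightarrow> 'k::{real_normed_field,euclidean_space}) \<Rightarrow> 'k) \<Rightarrow>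
   ((real^'m \<Rightarrow> 'k) \<Rightarrow> 'k) \<Rightarrow> bool" where
  "summable_wrt v a \<longleftrightarrow> a \<circ> family_operator v \<in> tempered_distributions"


section \<open>Carriers of the topologies\<close>

lemma iter_partial_deriv_zero: "iter_partial_deriv is (\<lambda>x. 0) = (\<lambda>x. 0)"
  unfolding iter_partial_deriv_def by (induction "is") (auto simp: partial_deriv_def)

lemma zero_in_schwartz_space: "(\<lambda>x. 0) \<in> schwartz_space"
  by (simp add: schwartz_space_def smooth_def iter_partial_deriv_zero)

lemma topspace_schwartz_topology: "topspace schwartz_topology = schwartz_space"
proof -
  have "schwartz_seminorm 0 [] (\<lambda>x. f x - f x) < 1"
    for f :: "real^'a \<Rightarrow> 'b::{real_normed_field,euclidean_space}"
    by (simp add: schwartz_seminorm_def iter_partial_deriv_zero)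
  then show ?thesis
    unfolding schwartz_topology_def topology_generated_by_topspace
    using zero_less_one by blast
qed

lemma zero_in_tempered_distributions: "(\<lambda>f. 0) \<in> tempered_distributions"
  by (simp add: tempered_distributions_def schwartz_algebraic_dual_def)

lemma topspace_schwartz_weak_topology: "topspace schwartz_weak_topology = schwartz_space"
  unfolding weak_topology_def topology_generated_by_topspace
  using zero_in_tempered_distributions open_UNIV by blast

lemma schwartz_family_linear_operator:
  "schwartz_family v \<Longrightarrow> schwartz_linear_operator (family_operator v)"
  by (auto simp: schwartz_family_def schwartz_linear_operator_def family_operator_def
      tempered_distributions_def schwartz_algebraic_dual_def)

end

theory Submission
  imports Defs
begin

text \<open>
  All four assertions are consequences of the last one, the continuity of \<open>family_operator v\<close> for
  the Frechet topologies: composing a tempered distribution with a continuous operator gives a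
  tempered distribution, which is summability and transposability, and transposability says that
  preimages of subbasic weakly open sets are subbasic weakly open. So it remains to see that every
  Schwartz family generates a continuous operator.

  The reason is the Banach-Steinhaus theorem on the space of test functions, applied twice
  (\<open>schwartz_uniform_boundedness\<close>). At a fixed point \<open>p\<close>, the functional
  \<open>\<phi> \<mapsto> v(\<phi>)(p)\<close> is continuous by hypothesis. A partial derivative of \<open>v(\<phi>)\<close> at
  \<open>p\<close> is a limit of difference quotients along a sequence, hence a pointwise limit of continuous
  functionals of \<open>\<phi>\<close>, and Banach-Steinhaus makes it continuous; by induction this holds for all
  iterated derivatives (\<open>iter_partial_deriv_family_bound\<close>). Next, multiply such a derivative by the
  weight \<open>(1 + norm p) ^ k\<close> and let \<open>p\<close> vary. Because \<open>v(\<phi>)\<close> is a Schwartz function, the resulting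
  family of functionals is pointwise bounded, so it is bounded by one continuous seminorm of
  \<open>\<phi>\<close>. This bounds every Schwartz seminorm of \<open>v(\<phi>)\<close>
  (\<open>family_operator_seminorm_bound\<close>).

  Banach-Steinhaus itself rests on the completeness of the Schwartz space
  (\<open>schwartz_space_complete\<close>), through a nested sequence of balls as in the Baire category theorem.
\<close>

section \<open>Partial derivatives of differentiable functions\<close>

lemma partial_deriv_has_derivative:
  fixes f :: "real^'n::finite \<Rightarrow> 'k::real_normed_vector"
  assumes "(f has_derivative D) (at x)"
  shows "partial_deriv i f x = D (axis i 1)"
    and "((\<lambda>t. f (x + t *\<^sub>R axis i 1)) has_vector_derivative D (axis i 1)) (at 0)"
proof -
  have "((\<lambda>t::real. x + t *\<^sub>R axis i 1) has_derivative (\<lambda>t. t *\<^sub>R axis i 1)) (at 0)"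
    by (auto intro!: derivative_eq_intros)
  moreover have "(f has_derivative D) (at (x + 0 *\<^sub>R axis i 1))"
    using assms by simp
  ultimately have "((\<lambda>t. f (x + t *\<^sub>R axis i 1)) has_derivative (\<lambda>t. D (t *\<^sub>R axis i 1))) (at 0)"
    by (rule has_derivative_compose)
  moreover have "linear D"
    using assms by (rule has_derivative_linear)
  ultimately show *: "((\<lambda>t. f (x + t *\<^sub>R axis i 1)) has_vector_derivative D (axis i 1)) (at 0)"
    by (simp add: has_vector_derivative_def linear_scale)
  show "partial_deriv i f x = D (axis i 1)"
    unfolding partial_deriv_def using * by (rule vector_derivative_at)
qed

lemma has_derivative_partial_deriv:
  fixes f :: "real^'n::finite \<Rightarrow> 'k::real_normed_vector"
  assumes "f differentiable (at x)"
  shows "(f has_derivative (\<lambda>h. \<Sum>i\<in>UNIV. h $ i *\<^sub>R partial_deriv i f x)) (at x)"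
proof -
  obtain D where D: "(f has_derivative D) (at x)"
    using assms unfolding differentiable_def by blast
  have "linear D"
    using D by (rule has_derivative_linear)
  have "D h = (\<Sum>i\<in>UNIV. h $ i *\<^sub>R partial_deriv i f x)" for h
  proof -
    have "D h = D (\<Sum>i\<in>UNIV. h $ i *\<^sub>R axis i 1)"
      using basis_expansion[of h] by (simp add: scalar_mult_eq_scaleR)
    also have "\<dots> = (\<Sum>i\<in>UNIV. h $ i *\<^sub>R partial_deriv i f x)"
      by (simp add: linear_sum[OF \<open>linear D\<close>] linear_scale[OF \<open>linear D\<close>]
          partial_deriv_has_derivative(1)[OF D])
    finally show ?thesis .
  qed
  then have "D = (\<lambda>h. \<Sum>i\<in>UNIV. h $ i *\<^sub>R partial_deriv i f x)"
    by (rule ext)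
  with D show ?thesis
    by simp
qed

lemma partial_deriv_quotient_tendsto:
  fixes f :: "real^'n::finite \<Rightarrow> 'k::real_normed_vector"
  assumes "f differentiable (at x)" "h \<longlonglongrightarrow> 0" "\<And>j. h j \<noteq> (0::real)"
  shows "(\<lambda>j. (f (x + h j *\<^sub>R axis i 1) - f x) /\<^sub>R h j) \<longlonglongrightarrow> partial_deriv i f x"
proof -
  obtain D where D: "(f has_derivative D) (at x)"
    using assms(1) unfolding differentiable_def by blast
  let ?F = "\<lambda>t. f (x + t *\<^sub>R axis i 1)"
  have "(?F has_vector_derivative partial_deriv i f x) (at 0)"
    using partial_deriv_has_derivative[OF D] by simp
  then have "((\<lambda>t. norm (?F t - ?F 0 - t *\<^sub>R partial_deriv i f x) / norm t) \<longlongrightarrow> 0) (at 0)"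
    by (simp add: has_vector_derivative_def has_derivative_at)
  moreover have "norm (?F t - ?F 0 - t *\<^sub>R partial_deriv i f x) / norm t
      = norm ((?F t - ?F 0) /\<^sub>R t - partial_deriv i f x)" if "t \<noteq> 0" for t :: real
  proof -
    have "(?F t - ?F 0) /\<^sub>R t - partial_deriv i f x
        = (?F t - ?F 0 - t *\<^sub>R partial_deriv i f x) /\<^sub>R t"
      using that by (simp add: scaleR_diff_right)
    then show ?thesis
      by (simp add: divide_inverse mult.commute)
  qed
  ultimately have "((\<lambda>t. norm ((?F t - ?F 0) /\<^sub>R t - partial_deriv i f x)) \<longlongrightarrow> 0) (at 0)"
    by (elim Lim_transform_eventually) (auto simp: eventually_at_filter)
  then have "((\<lambda>t. (?F t - ?F 0) /\<^sub>R t) \<longlongrightarrow> partial_deriv i f x) (at 0)"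
    using Lim_null tendsto_norm_zero_iff by blast
  moreover have "filterlim h (at 0) sequentially"
    using assms(2,3) by (simp add: filterlim_at)
  ultimately have "((\<lambda>j. (?F (h j) - ?F 0) /\<^sub>R h j) \<longlongrightarrow> partial_deriv i f x) sequentially"
    by (rule filterlim_compose)
  then show ?thesis
    by simp
qed

lemma iter_partial_deriv_simps [simp]:
  "iter_partial_deriv [] f = f"
  "iter_partial_deriv (i # is) f = partial_deriv i (iter_partial_deriv is f)"
  by (simp_all add: iter_partial_deriv_def)

text \<open>
  Linear combinations are treated in one step; sums, differences and scalar multiples are the
  instances with coefficients \<open>0\<close>, \<open>1\<close> and \<open>-1\<close>.
\<close>

lemma iter_partial_deriv_combination:
  fixes f g :: "real^'n::finite \<Rightarrow> 'k::{real_normed_field,euclidean_space}"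
  assumes "smooth f" "smooth g"
  shows "iter_partial_deriv is (\<lambda>x. c * f x + d * g x) =
    (\<lambda>x. c * iter_partial_deriv is f x + d * iter_partial_deriv is g x)"
proof (induction "is")
  case (Cons i "is")
  show ?case
  proof
    fix x
    obtain F G where F: "(iter_partial_deriv is f has_derivative F) (at x)"
      and G: "(iter_partial_deriv is g has_derivative G) (at x)"
      using assms unfolding smooth_def differentiable_def by blast
    have "((\<lambda>x. c * iter_partial_deriv is f x + d * iter_partial_deriv is g x) has_derivative
        (\<lambda>h. c * F h + d * G h)) (at x)"
      by (intro has_derivative_add has_derivative_mult_right F G)
    then show "iter_partial_deriv (i # is) (\<lambda>x. c * f x + d * g x) x =
        c * iter_partial_deriv (i # is) f x + d * iter_partial_deriv (i # is) g x"
      by (simp add: Cons.IH partial_deriv_has_derivative(1) partial_deriv_has_derivative(1)[OF F]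
          partial_deriv_has_derivative(1)[OF G])
  qed
qed simp

lemma smooth_combination:
  fixes f g :: "real^'n::finite \<Rightarrow> 'k::{real_normed_field,euclidean_space}"
  assumes "smooth f" "smooth g"
  shows "smooth (\<lambda>x. c * f x + d * g x)"
  using assms
  by (auto simp: smooth_def iter_partial_deriv_combination[OF assms]
      intro!: differentiable_add differentiable_mult differentiable_const)


section \<open>The Schwartz seminorms\<close>

lemma schwartz_seminorm_upper:
  assumes "f \<in> schwartz_space"
  shows "(1 + norm x) ^ k * norm (iter_partial_deriv is f x) \<le> schwartz_seminorm k is f"
  using assms unfolding schwartz_seminorm_def schwartz_space_def
  by (auto intro!: cSUP_upper)

lemma schwartz_seminorm_least:
  assumes "\<And>x. (1 + norm x) ^ k * norm (iter_partial_deriv is f x) \<le> B"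
  shows "schwartz_seminorm k is f \<le> B"
  unfolding schwartz_seminorm_def using assms by (auto intro!: cSUP_least)

lemma schwartz_seminorm_nonneg:
  assumes "f \<in> schwartz_space"
  shows "0 \<le> schwartz_seminorm k is f"
  using schwartz_seminorm_upper[OF assms, of 0 k "is"]
  by (rule order_trans[rotated]) simp

lemma schwartz_combination_pointwise:
  fixes f g :: "real^'n::finite \<Rightarrow> 'k::{real_normed_field,euclidean_space}"
  assumes "f \<in> schwartz_space" "g \<in> schwartz_space"
  shows "(1 + norm x) ^ k * norm (iter_partial_deriv is (\<lambda>x. c * f x + d * g x) x)
    \<le> norm c * schwartz_seminorm k is f + norm d * schwartz_seminorm k is g"
proof -
  have sm: "smooth f" "smooth g"
    using assms by (auto simp: schwartz_space_def)
  let ?w = "(1 + norm x) ^ k"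
  have "?w * norm (iter_partial_deriv is (\<lambda>x. c * f x + d * g x) x)
      \<le> ?w * (norm c * norm (iter_partial_deriv is f x) + norm d * norm (iter_partial_deriv is g x))"
    unfolding iter_partial_deriv_combination[OF sm]
    by (intro mult_left_mono) (auto intro: norm_triangle_le simp: norm_mult)
  also have "\<dots> = norm c * (?w * norm (iter_partial_deriv is f x)) +
      norm d * (?w * norm (iter_partial_deriv is g x))"
    by (simp add: algebra_simps)
  also have "\<dots> \<le> norm c * schwartz_seminorm k is f + norm d * schwartz_seminorm k is g"
    by (intro add_mono mult_left_mono schwartz_seminorm_upper assms) auto
  finally show ?thesis .
qed

lemma schwartz_space_combination:
  fixes f g :: "real^'n::finite \<Rightarrow> 'k::{real_normed_field,euclidean_space}"
  assumes "f \<in> schwartz_space" "g \<in> schwartz_space"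
  shows "(\<lambda>x. c * f x + d * g x) \<in> schwartz_space"
  using assms smooth_combination[of f g c d] schwartz_combination_pointwise[OF assms, of _ _ _ c d]
  by (auto simp: schwartz_space_def bdd_above_def)

lemma schwartz_seminorm_combination:
  fixes f g :: "real^'n::finite \<Rightarrow> 'k::{real_normed_field,euclidean_space}"
  assumes "f \<in> schwartz_space" "g \<in> schwartz_space"
  shows "schwartz_seminorm k is (\<lambda>x. c * f x + d * g x)
    \<le> norm c * schwartz_seminorm k is f + norm d * schwartz_seminorm k is g"
  by (intro schwartz_seminorm_least schwartz_combination_pointwise assms)

lemma schwartz_space_add:
  assumes "f \<in> schwartz_space" "g \<in> schwartz_space"
  shows "(\<lambda>x. f x + g x) \<in> schwartz_space"
  using schwartz_space_combination[OF assms, of 1 1] by simp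

lemma schwartz_space_diff:
  assumes "f \<in> schwartz_space" "g \<in> schwartz_space"
  shows "(\<lambda>x. f x - g x) \<in> schwartz_space"
  using schwartz_space_combination[OF assms, of 1 "-1"] by simp

lemma schwartz_space_scale:
  assumes "f \<in> schwartz_space"
  shows "(\<lambda>x. c * f x) \<in> schwartz_space"
  using schwartz_space_combination[OF assms assms, of c 0] by simp

lemma iter_partial_deriv_diff:
  fixes f g :: "real^'n::finite \<Rightarrow> 'k::{real_normed_field,euclidean_space}"
  assumes "f \<in> schwartz_space" "g \<in> schwartz_space"
  shows "iter_partial_deriv is (\<lambda>x. f x - g x) x =
    iter_partial_deriv is f x - iter_partial_deriv is g x"
  using iter_partial_deriv_combination[of f g "is" 1 "-1"] assms
  by (simp add: schwartz_space_def)

lemma schwartz_seminorm_triangle: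
  fixes f g h :: "real^'n::finite \<Rightarrow> 'k::{real_normed_field,euclidean_space}"
  assumes "f \<in> schwartz_space" "g \<in> schwartz_space" "h \<in> schwartz_space"
  shows "schwartz_seminorm k is (\<lambda>x. f x - h x)
    \<le> schwartz_seminorm k is (\<lambda>x. f x - g x) + schwartz_seminorm k is (\<lambda>x. g x - h x)"
  using schwartz_seminorm_combination[OF schwartz_space_diff[OF assms(1,2)]
      schwartz_space_diff[OF assms(2,3)], of k "is" 1 1]
  by simp

lemma schwartz_seminorm_mono:
  fixes f :: "real^'n::finite \<Rightarrow> 'k::{real_normed_field,euclidean_space}"
  assumes "f \<in> schwartz_space" "k \<le> l"
  shows "schwartz_seminorm k is f \<le> schwartz_seminorm l is f"
proof (rule schwartz_seminorm_least)
  fix x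
  have "(1 + norm x) ^ k * norm (iter_partial_deriv is f x)
      \<le> (1 + norm x) ^ l * norm (iter_partial_deriv is f x)"
    using assms(2) by (intro mult_right_mono power_increasing) auto
  also have "\<dots> \<le> schwartz_seminorm l is f"
    by (rule schwartz_seminorm_upper[OF assms(1)])
  finally show "(1 + norm x) ^ k * norm (iter_partial_deriv is f x) \<le> schwartz_seminorm l is f" .
qed

text \<open>
  An increasing sequence of seminorms that generates the same topology: a single one of them
  dominates any finite number of the seminorms \<open>schwartz_seminorm k is\<close>, so balls for it form
  bases of neighbourhoods and one inequality expresses the continuity of a functional.
\<close>

definition schwartz_norm ::
  "nat \<Rightarrow> (real^'n::finite \<Rightarrow> 'k::{real_normed_field,euclidean_space}) \<Rightarrow> real" where
  "schwartz_norm N f = (\<Sum>is | length is \<le> N. schwartz_seminorm N is f)"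

lemma finite_short_lists: "finite {is :: 'n::finite list. length is \<le> N}"
  using finite_lists_length_le[of "UNIV :: 'n set" N] by simp

lemma schwartz_norm_nonneg: "f \<in> schwartz_space \<Longrightarrow> 0 \<le> schwartz_norm N f"
  unfolding schwartz_norm_def by (intro sum_nonneg schwartz_seminorm_nonneg)

lemma schwartz_norm_combination:
  fixes f g :: "real^'n::finite \<Rightarrow> 'k::{real_normed_field,euclidean_space}"
  assumes "f \<in> schwartz_space" "g \<in> schwartz_space"
  shows "schwartz_norm N (\<lambda>x. c * f x + d * g x)
    \<le> norm c * schwartz_norm N f + norm d * schwartz_norm N g"
  unfolding schwartz_norm_def sum_distrib_left sum.distrib[symmetric]
  by (intro sum_mono schwartz_seminorm_combination assms)

lemma schwartz_norm_scale:
  fixes f :: "real^'n::finite \<Rightarrow> 'k::{real_normed_field,euclidean_space}"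
  assumes "f \<in> schwartz_space"
  shows "schwartz_norm N (\<lambda>x. c * f x) \<le> norm c * schwartz_norm N f"
  using schwartz_norm_combination[OF assms assms, of N c 0] by simp

lemma schwartz_norm_triangle:
  fixes f g h :: "real^'n::finite \<Rightarrow> 'k::{real_normed_field,euclidean_space}"
  assumes "f \<in> schwartz_space" "g \<in> schwartz_space" "h \<in> schwartz_space"
  shows "schwartz_norm N (\<lambda>x. f x - h x)
    \<le> schwartz_norm N (\<lambda>x. f x - g x) + schwartz_norm N (\<lambda>x. g x - h x)"
  using schwartz_norm_combination[OF schwartz_space_diff[OF assms(1,2)]
      schwartz_space_diff[OF assms(2,3)], of N 1 1]
  by simp

lemma schwartz_norm_zero [simp]: "schwartz_norm N (\<lambda>x. 0) = 0"
  by (simp add: schwartz_norm_def schwartz_seminorm_def iter_partial_deriv_zero)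

lemma schwartz_norm_mono:
  fixes f :: "real^'n::finite \<Rightarrow> 'k::{real_normed_field,euclidean_space}"
  assumes "f \<in> schwartz_space" "M \<le> N"
  shows "schwartz_norm M f \<le> schwartz_norm N f"
proof -
  have "schwartz_norm M f \<le> (\<Sum>is | length is \<le> M. schwartz_seminorm N is f)"
    unfolding schwartz_norm_def using assms by (intro sum_mono schwartz_seminorm_mono)
  also have "\<dots> \<le> schwartz_norm N f"
    unfolding schwartz_norm_def using assms
    by (intro sum_mono2 finite_short_lists schwartz_seminorm_nonneg) auto
  finally show ?thesis .
qed

lemma schwartz_seminorm_le_norm:
  fixes f :: "real^'n::finite \<Rightarrow> 'k::{real_normed_field,euclidean_space}"
  assumes "f \<in> schwartz_space" "k \<le> N" "length is \<le> N"
  shows "schwartz_seminorm k is f \<le> schwartz_norm N f"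
proof -
  have "schwartz_seminorm k is f \<le> schwartz_seminorm N is f"
    using assms by (intro schwartz_seminorm_mono)
  also have "\<dots> \<le> schwartz_norm N f"
    unfolding schwartz_norm_def using assms
    by (intro member_le_sum finite_short_lists schwartz_seminorm_nonneg) auto
  finally show ?thesis .
qed


section \<open>Neighbourhoods in the Schwartz topology\<close>

text \<open>
  Translation between the subbase that generates the topology and balls of \<open>schwartz_norm\<close>: finite
  intersections of subbasic sets correspond to enlarging the index, because the seminorms increase.
\<close>

lemma schwartz_topology_ball_subset:
  fixes U :: "(real^'n::finite \<Rightarrow> 'k::{real_normed_field,euclidean_space}) set"
  assumes "openin schwartz_topology U" "f \<in> U"
  shows "\<exists>N r. 0 < r \<and> {g \<in> schwartz_space. schwartz_norm N (\<lambda>x. g x - f x) < r} \<subseteq> U"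
proof -
  have "generate_topology_on {{f \<in> schwartz_space. schwartz_seminorm k is (\<lambda>x. f x - g x) < r} | k is g r.
        g \<in> schwartz_space \<and> 0 < r} U"
    using assms(1) unfolding schwartz_topology_def openin_topology_generated_by_iff .
  moreover have "f \<in> schwartz_space"
    using openin_subset[OF assms(1)] assms(2) by (auto simp: topspace_schwartz_topology)
  ultimately show ?thesis using assms(2)
  proof (induction U arbitrary: f)
    case Empty
    then show ?case by simp
  next
    case (Int A B)
    from Int.IH(1)[of f] Int.prems obtain M r where A: "0 < r"
      "{g \<in> schwartz_space. schwartz_norm M (\<lambda>x. g x - f x) < r} \<subseteq> A" by auto
    from Int.IH(2)[of f] Int.prems obtain N s where B: "0 < s"
      "{g \<in> schwartz_space. schwartz_norm N (\<lambda>x. g x - f x) < s} \<subseteq> B" by auto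
    have "{g \<in> schwartz_space. schwartz_norm (max M N) (\<lambda>x. g x - f x) < min r s} \<subseteq> A \<inter> B"
    proof
      fix g assume g: "g \<in> {g \<in> schwartz_space. schwartz_norm (max M N) (\<lambda>x. g x - f x) < min r s}"
      then have "(\<lambda>x. g x - f x) \<in> schwartz_space"
        using Int.prems by (auto intro: schwartz_space_diff)
      from schwartz_norm_mono[OF this, of M "max M N"] schwartz_norm_mono[OF this, of N "max M N"]
      show "g \<in> A \<inter> B" using g A(2) B(2) by auto
    qed
    with A(1) B(1) show ?case by (intro exI[of _ "max M N"] exI[of _ "min r s"]) auto
  next
    case (UN K)
    then show ?case by (meson Union_iff Union_upper order_trans)
  next
    case (Basis s)
    then obtain k "is" g r where s: "s = {f \<in> schwartz_space. schwartz_seminorm k is (\<lambda>x. f x - g x) < r}"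
      and g: "g \<in> schwartz_space" by blast
    have f: "f \<in> schwartz_space" and d: "schwartz_seminorm k is (\<lambda>x. f x - g x) < r"
      using Basis.prems s by auto
    let ?N = "max k (length is)" and ?d = "r - schwartz_seminorm k is (\<lambda>x. f x - g x)"
    have "h \<in> s" if h: "h \<in> schwartz_space" "schwartz_norm ?N (\<lambda>x. h x - f x) < ?d" for h
    proof -
      have "schwartz_seminorm k is (\<lambda>x. h x - f x) \<le> schwartz_norm ?N (\<lambda>x. h x - f x)"
        by (intro schwartz_seminorm_le_norm schwartz_space_diff h f) auto
      with schwartz_seminorm_triangle[OF h(1) f g, of k "is"] h d show ?thesis
        unfolding s by auto
    qed
    with d show ?case by (intro exI[of _ ?N] exI[of _ ?d]) auto
  qed
qed

lemma openin_schwartz_topologyI: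
  fixes U :: "(real^'n::finite \<Rightarrow> 'k::{real_normed_field,euclidean_space}) set"
  assumes "U \<subseteq> schwartz_space"
    and ball: "\<And>f. f \<in> U \<Longrightarrow>
      \<exists>N r. 0 < r \<and> {g \<in> schwartz_space. schwartz_norm N (\<lambda>x. g x - f x) < r} \<subseteq> U"
  shows "openin schwartz_topology U"
proof (subst openin_subopen, intro ballI)
  fix f assume "f \<in> U"
  with ball obtain N r where r: "0 < r"
    and sub: "{g \<in> schwartz_space. schwartz_norm N (\<lambda>x. g x - f x) < r} \<subseteq> U" by blast
  have f: "f \<in> schwartz_space" using assms(1) \<open>f \<in> U\<close> by blast
  \<comment> \<open>If each of the summands of \<open>schwartz_norm N\<close> is below \<open>?e\<close>, then their sum is below \<open>r\<close>.\<close>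
  let ?L = "{is :: 'n list. length is \<le> N}"
  let ?e = "r / real (card ?L)"
  let ?B = "\<lambda>is. {g \<in> schwartz_space. schwartz_seminorm N is (\<lambda>x. g x - f x) < ?e}"
  have ne: "?L \<noteq> {}" by (auto intro: exI[of _ "[]"])
  then have "0 < card ?L" using finite_short_lists[where 'n='n] by (subst card_gt_0_iff) blast
  with r have e: "0 < ?e" by simp
  have "openin schwartz_topology (?B is)" for "is"
    unfolding schwartz_topology_def
    by (rule topology_generated_by_Basis) (use f e in blast)
  then have op: "openin schwartz_topology (\<Inter>is\<in>?L. ?B is)"
    using ne by (intro openin_INT2 finite_short_lists) auto
  have "f \<in> ?B is" for "is"
    using f e by (simp add: schwartz_seminorm_def iter_partial_deriv_zero)
  then have fin: "f \<in> (\<Inter>is\<in>?L. ?B is)" by blast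
  have "(\<Inter>is\<in>?L. ?B is) \<subseteq> U"
  proof
    fix g assume g: "g \<in> (\<Inter>is\<in>?L. ?B is)"
    then have "g \<in> schwartz_space" using ne by blast
    have "schwartz_norm N (\<lambda>x. g x - f x) < (\<Sum>is\<in>?L. ?e)"
      unfolding schwartz_norm_def
      using g ne by (intro sum_strict_mono finite_short_lists) blast+
    also have "\<dots> = r" using ne finite_short_lists[where 'n='n] by simp
    finally show "g \<in> U" using sub \<open>g \<in> schwartz_space\<close> by blast
  qed
  with op fin show "\<exists>T. openin schwartz_topology T \<and> f \<in> T \<and> T \<subseteq> U" by blast
qed


section \<open>Completeness of the Schwartz space\<close>

text \<open>
  For a Cauchy sequence, every iterated partial derivative converges uniformly to some function
  \<open>G is\<close>. Since the total derivative is the combination of the partial derivatives, it converges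
  uniformly too, so limits and derivatives can be interchanged: \<open>G (i # is)\<close> is the partial
  derivative of \<open>G is\<close>, and \<open>G []\<close> is a smooth function with derivatives \<open>G is\<close>. The weighted
  estimates pass to the limit pointwise.
\<close>

lemma schwartz_space_complete:
  fixes f :: "nat \<Rightarrow> real^'n::finite \<Rightarrow> 'k::{real_normed_field,euclidean_space}"
  assumes f: "\<And>j. f j \<in> schwartz_space"
    and Cauchy: "\<And>k is e. 0 < e \<Longrightarrow>
      \<exists>M. \<forall>a\<ge>M. \<forall>b\<ge>M. schwartz_seminorm k is (\<lambda>x. f a x - f b x) < e"
  shows "\<exists>g\<in>schwartz_space. \<forall>k is. (\<lambda>j. schwartz_seminorm k is (\<lambda>x. f j x - g x)) \<longlonglongrightarrow> 0"
proof -
  have unif: "\<exists>M. \<forall>a\<ge>M. \<forall>b\<ge>M. \<forall>x. (1 + norm x) ^ k *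
      norm (iter_partial_deriv is (f a) x - iter_partial_deriv is (f b) x) < e" if "0 < e" for k "is" e
  proof -
    have "(1 + norm x) ^ k * norm (iter_partial_deriv is (f a) x - iter_partial_deriv is (f b) x)
      \<le> schwartz_seminorm k is (\<lambda>x. f a x - f b x)" for a b x
      using schwartz_seminorm_upper[OF schwartz_space_diff[OF f f]]
      by (simp add: iter_partial_deriv_diff[OF f f])
    with Cauchy[OF that, of k "is"] show ?thesis
      by (meson order_le_less_trans)
  qed
  define G where "G is x = lim (\<lambda>j. iter_partial_deriv is (f j) x)" for "is" x
  have G: "(\<lambda>j. iter_partial_deriv is (f j) x) \<longlonglongrightarrow> G is x" for "is" x
  proof -
    have "Cauchy (\<lambda>j. iter_partial_deriv is (f j) x)"
      unfolding Cauchy_def dist_norm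
    proof (intro allI impI)
      fix e :: real assume "0 < e"
      from unif[OF this, of 0 "is"]
      show "\<exists>M. \<forall>m\<ge>M. \<forall>n\<ge>M. norm (iter_partial_deriv is (f m) x - iter_partial_deriv is (f n) x) < e"
        by auto
    qed
    then show ?thesis
      unfolding G_def using Cauchy_convergent_iff convergent_LIMSEQ_iff by blast
  qed
  have close: "\<exists>M. \<forall>a\<ge>M. \<forall>x. (1 + norm x) ^ k * norm (iter_partial_deriv is (f a) x - G is x) \<le> e"
    if "0 < e" for k "is" e
  proof -
    obtain M where M: "\<And>a b x. M \<le> a \<Longrightarrow> M \<le> b \<Longrightarrow> (1 + norm x) ^ k *
      norm (iter_partial_deriv is (f a) x - iter_partial_deriv is (f b) x) < e"
      using unif[OF \<open>0 < e\<close>, of k "is"] by blast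
    have "(1 + norm x) ^ k * norm (iter_partial_deriv is (f a) x - G is x) \<le> e" if "M \<le> a" for a x
    proof (rule LIMSEQ_le_const2)
      show "(\<lambda>b. (1 + norm x) ^ k * norm (iter_partial_deriv is (f a) x - iter_partial_deriv is (f b) x))
        \<longlonglongrightarrow> (1 + norm x) ^ k * norm (iter_partial_deriv is (f a) x - G is x)"
        by (intro tendsto_intros G)
      show "\<exists>N. \<forall>b\<ge>N. (1 + norm x) ^ k *
          norm (iter_partial_deriv is (f a) x - iter_partial_deriv is (f b) x) \<le> e"
        using M[OF that] less_imp_le by blast
    qed
    then show ?thesis by blast
  qed
  have deriv: "(G is has_derivative (\<lambda>h. \<Sum>i\<in>UNIV. h $ i *\<^sub>R G (i # is) x)) (at x)" for "is" x
  proof -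
    have "\<exists>g. \<forall>x\<in>UNIV. (\<lambda>j. iter_partial_deriv is (f j) x) \<longlonglongrightarrow> g x \<and>
        (g has_derivative (\<lambda>h. \<Sum>i\<in>UNIV. h $ i *\<^sub>R G (i # is) x)) (at x within UNIV)"
    proof (rule has_derivative_sequence)
      show "(iter_partial_deriv is (f j) has_derivative
          (\<lambda>h. \<Sum>i\<in>UNIV. h $ i *\<^sub>R iter_partial_deriv (i # is) (f j) x)) (at x within UNIV)" for j x
        using f[of j] has_derivative_partial_deriv[of "iter_partial_deriv is (f j)" x]
        by (simp add: schwartz_space_def smooth_def)
      show "\<forall>\<^sub>F j in sequentially. \<forall>x\<in>UNIV. \<forall>h.
          norm ((\<Sum>i\<in>UNIV. h $ i *\<^sub>R iter_partial_deriv (i # is) (f j) x) -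
            (\<Sum>i\<in>UNIV. h $ i *\<^sub>R G (i # is) x)) \<le> e * norm h" if "0 < e" for e
      proof -
        let ?d = "e / real CARD('n)"
        have d: "0 < ?d" using that by simp
        have "\<forall>\<^sub>F j in sequentially. \<forall>x. norm (iter_partial_deriv (i # is) (f j) x - G (i # is) x) \<le> ?d" for i
          using close[OF d, of 0 "i # is"] unfolding eventually_sequentially by simp
        then have "\<forall>\<^sub>F j in sequentially. \<forall>i\<in>UNIV. \<forall>x.
            norm (iter_partial_deriv (i # is) (f j) x - G (i # is) x) \<le> ?d"
          by (intro eventually_ball_finite) auto
        then show ?thesis
        proof (rule eventually_mono, intro ballI allI)
          fix j x and h :: "real^'n"
          assume j: "\<forall>i\<in>UNIV. \<forall>x. norm (iter_partial_deriv (i # is) (f j) x - G (i # is) x) \<le> ?d"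
          have "norm ((\<Sum>i\<in>UNIV. h $ i *\<^sub>R iter_partial_deriv (i # is) (f j) x) -
              (\<Sum>i\<in>UNIV. h $ i *\<^sub>R G (i # is) x)) =
              norm (\<Sum>i\<in>UNIV. h $ i *\<^sub>R (iter_partial_deriv (i # is) (f j) x - G (i # is) x))"
            by (simp add: sum_subtractf scaleR_diff_right)
          also have "\<dots> \<le> (\<Sum>i\<in>(UNIV::'n set). norm h * ?d)"
          proof (rule sum_norm_le)
            fix i
            have "\<bar>h $ i\<bar> * norm (iter_partial_deriv (i # is) (f j) x - G (i # is) x) \<le> norm h * ?d"
              using j by (intro mult_mono component_le_norm_cart) auto
            then show "norm (h $ i *\<^sub>R (iter_partial_deriv (i # is) (f j) x - G (i # is) x)) \<le> norm h * ?d"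
              by simp
          qed
          also have "\<dots> = e * norm h" by simp
          finally show "norm ((\<Sum>i\<in>UNIV. h $ i *\<^sub>R iter_partial_deriv (i # is) (f j) x) -
              (\<Sum>i\<in>UNIV. h $ i *\<^sub>R G (i # is) x)) \<le> e * norm h" .
        qed
      qed
      show "(\<lambda>j. iter_partial_deriv is (f j) 0) \<longlonglongrightarrow> G is 0" by (rule G)
    qed auto
    then obtain g where g: "\<And>x. (\<lambda>j. iter_partial_deriv is (f j) x) \<longlonglongrightarrow> g x"
      and D: "\<And>x. (g has_derivative (\<lambda>h. \<Sum>i\<in>UNIV. h $ i *\<^sub>R G (i # is) x)) (at x)"
      by auto
    have "g = G is" using LIMSEQ_unique[OF g G] by blast
    with D show ?thesis by simp
  qed
  have iter: "iter_partial_deriv is (G []) = G is" for "is"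
  proof (induction "is")
    case (Cons i "is")
    have "partial_deriv i (G is) x = G (i # is) x" for x
      unfolding partial_deriv_has_derivative(1)[OF deriv]
      by (simp add: axis_def if_distrib[of "\<lambda>c. c *\<^sub>R _"] sum.delta cong: if_cong)
    then show ?case using Cons by auto
  qed simp
  have "smooth (G [])"
    unfolding smooth_def iter differentiable_def using deriv by blast
  moreover have "bdd_above (range (\<lambda>x. (1 + norm x) ^ k * norm (G is x)))" for k "is"
  proof -
    obtain a where a: "\<And>x. (1 + norm x) ^ k * norm (iter_partial_deriv is (f a) x - G is x) \<le> 1"
      using close[of 1 k "is"] by auto
    have "(1 + norm x) ^ k * norm (G is x) \<le> 1 + schwartz_seminorm k is (f a)" for x
    proof -
      have "norm (G is x) \<le> norm (iter_partial_deriv is (f a) x - G is x) + norm (iter_partial_deriv is (f a) x)"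
        by norm
      then have "(1 + norm x) ^ k * norm (G is x) \<le> (1 + norm x) ^ k *
          (norm (iter_partial_deriv is (f a) x - G is x) + norm (iter_partial_deriv is (f a) x))"
        by (intro mult_left_mono) auto
      also have "\<dots> \<le> 1 + schwartz_seminorm k is (f a)"
        unfolding distrib_left by (intro add_mono a schwartz_seminorm_upper f)
      finally show ?thesis .
    qed
    then show ?thesis by (auto simp: bdd_above_def)
  qed
  ultimately have g: "G [] \<in> schwartz_space"
    by (simp add: schwartz_space_def iter)
  moreover have "(\<lambda>j. schwartz_seminorm k is (\<lambda>x. f j x - G [] x)) \<longlonglongrightarrow> 0" for k "is"
  proof (rule LIMSEQ_I)
    fix e :: real assume "0 < e"
    then obtain M where M: "\<And>a x. M \<le> a \<Longrightarrow>
        (1 + norm x) ^ k * norm (iter_partial_deriv is (f a) x - G is x) \<le> e / 2"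
      using close[of "e / 2" k "is"] by auto
    have le: "schwartz_seminorm k is (\<lambda>x. f a x - G [] x) \<le> e / 2" if "M \<le> a" for a
      using M[OF that] by (intro schwartz_seminorm_least) (simp add: iter_partial_deriv_diff[OF f g] iter)
    have nonneg: "0 \<le> schwartz_seminorm k is (\<lambda>x. f a x - G [] x)" for a
      by (intro schwartz_seminorm_nonneg schwartz_space_diff f g)
    have "norm (schwartz_seminorm k is (\<lambda>x. f a x - G [] x) - 0) < e" if "M \<le> a" for a
      using le[OF that] nonneg[of a] \<open>0 < e\<close> by simp
    then show "\<exists>M. \<forall>a\<ge>M. norm (schwartz_seminorm k is (\<lambda>x. f a x - G [] x) - 0) < e" by blast
  qed
  ultimately show ?thesis by blast
qed


section \<open>Uniform boundedness\<close>

lemma algebraic_dual_diff: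
  fixes a :: "(real^'n::finite \<Rightarrow> 'k::{real_normed_field,euclidean_space}) \<Rightarrow> 'k"
  assumes "a \<in> schwartz_algebraic_dual" "f \<in> schwartz_space" "g \<in> schwartz_space"
  shows "a (\<lambda>x. f x - g x) = a f - a g"
proof -
  have "a (\<lambda>x. f x + (-1) * g x) = a f + a (\<lambda>x. (-1) * g x)"
    using assms schwartz_space_scale[OF assms(3), of "-1"]
    unfolding schwartz_algebraic_dual_def mem_Collect_eq by fast
  also have "a (\<lambda>x. (-1) * g x) = (-1) * a g"
    using assms unfolding schwartz_algebraic_dual_def mem_Collect_eq by fast
  finally show ?thesis by simp
qed

text \<open>Homogeneity turns a bound on a ball around zero into a bound by the seminorm.\<close>

lemma bound_from_ball:
  fixes a :: "(real^'n::finite \<Rightarrow> 'k::{real_normed_field,euclidean_space}) \<Rightarrow> 'k"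
  assumes a: "a \<in> schwartz_algebraic_dual" and r: "0 < r"
    and ball: "\<And>f. f \<in> schwartz_space \<Longrightarrow> schwartz_norm N f < r \<Longrightarrow> norm (a f) \<le> B"
    and f: "f \<in> schwartz_space"
  shows "norm (a f) \<le> B / r * schwartz_norm N f"
proof -
  let ?s = "schwartz_norm N f"
  have s: "0 \<le> ?s" by (rule schwartz_norm_nonneg[OF f])
  have "norm (a f) * r \<le> B * (?s + e)" if "0 < e" for e
  proof -
    \<comment> \<open>The summand \<open>e\<close> covers the case that the seminorm of \<open>f\<close> vanishes.\<close>
    define c :: 'k where "c = of_real (r / (?s + e))"
    have c: "norm c = r / (?s + e)" using s r that unfolding c_def norm_of_real by simp
    have "schwartz_norm N (\<lambda>x. c * f x) \<le> r / (?s + e) * ?s"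
      using schwartz_norm_scale[OF f, of N c] c by simp
    also have "\<dots> < r"
      using s r that by (simp add: field_simps)
    finally have "norm (a (\<lambda>x. c * f x)) \<le> B"
      by (intro ball schwartz_space_scale f)
    moreover have "a (\<lambda>x. c * f x) = c * a f"
      using a f by (simp add: schwartz_algebraic_dual_def)
    ultimately show ?thesis
      using c s that by (simp add: norm_mult field_simps)
  qed
  then have "(\<And>e. 0 < e \<Longrightarrow> norm (a f) * r \<le> B * ?s + B * e)"
    by (simp add: distrib_left)
  moreover have "((\<lambda>e. B * ?s + B * e) \<longlongrightarrow> B * ?s + B * 0) (at_right 0)"
    by (intro tendsto_intros)
  ultimately have "norm (a f) * r \<le> B * ?s + B * 0"
    by (intro tendsto_lowerbound[where F="at_right (0::real)"])
      (auto simp: eventually_at_right_field intro: exI[of _ 1])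
  then show ?thesis using r by (simp add: field_simps)
qed

lemma tempered_distribution_bound:
  fixes a :: "(real^'n::finite \<Rightarrow> 'k::{real_normed_field,euclidean_space}) \<Rightarrow> 'k"
  assumes "a \<in> tempered_distributions"
  shows "\<exists>C N. \<forall>f\<in>schwartz_space. norm (a f) \<le> C * schwartz_norm N f"
proof -
  have lin: "a \<in> schwartz_algebraic_dual" and cont: "continuous_map schwartz_topology euclidean a"
    using assms by (auto simp: tempered_distributions_def)
  let ?U = "{f \<in> schwartz_space. a f \<in> ball 0 1}"
  have "openin schwartz_topology ?U"
    using openin_continuous_map_preimage[OF cont, of "ball 0 1"]
    by (simp add: topspace_schwartz_topology)
  moreover have "a (\<lambda>x. 0) = 0"
    using algebraic_dual_diff[OF lin zero_in_schwartz_space zero_in_schwartz_space] by simp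
  then have "(\<lambda>x. 0) \<in> ?U" using zero_in_schwartz_space by simp
  ultimately obtain N r where r: "0 < r"
    "{g \<in> schwartz_space. schwartz_norm N (\<lambda>x. g x - 0) < r} \<subseteq> ?U"
    using schwartz_topology_ball_subset by blast
  have "norm (a f) \<le> 1" if "f \<in> schwartz_space" "schwartz_norm N f < r" for f
    using r(2) that by auto
  from bound_from_ball[OF lin r(1) this] show ?thesis by blast
qed

text \<open>
  Suppose that no common bound exists. Then on every ball the functionals take arbitrarily large
  values (\<open>large\<close>): a common bound \<open>B\<close> on a ball around \<open>x\<close> would give the bound \<open>2 * B\<close> on a
  ball around zero, by subtracting the value at \<open>x\<close>. Since each functional is continuous, a large
  value persists on a smaller ball. So there is a nested sequence of balls with indices tending to
  infinity and radii tending to zero, on the \<open>n\<close>-th of which some functional exceeds \<open>n\<close>. The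
  centres form a Cauchy sequence, and at their limit the functionals are not pointwise bounded.
\<close>

lemma schwartz_uniform_boundedness:
  fixes T :: "'i \<Rightarrow> (real^'n::finite \<Rightarrow> 'k::{real_normed_field,euclidean_space}) \<Rightarrow> 'k"
  assumes lin: "\<And>j. T j \<in> schwartz_algebraic_dual"
    and bdd: "\<And>j. \<exists>C N. \<forall>f\<in>schwartz_space. norm (T j f) \<le> C * schwartz_norm N f"
    and pw: "\<And>f. f \<in> schwartz_space \<Longrightarrow> \<exists>B. \<forall>j. norm (T j f) \<le> B"
  shows "\<exists>C N. \<forall>j. \<forall>f\<in>schwartz_space. norm (T j f) \<le> C * schwartz_norm N f"
proof (rule ccontr)
  assume unbounded: "\<not> ?thesis"
  have large: "\<exists>y\<in>schwartz_space. \<exists>j. schwartz_norm N (\<lambda>t. y t - x t) < r \<and> B < norm (T j y)"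
    if x: "x \<in> schwartz_space" and r: "0 < r" for x :: "real^'n \<Rightarrow> 'k" and N :: nat and r B :: real
  proof (rule ccontr)
    assume "\<not> ?thesis"
    then have B: "norm (T j y) \<le> B" if "y \<in> schwartz_space" "schwartz_norm N (\<lambda>t. y t - x t) < r" for j y
      using that by (meson not_le)
    have "norm (T j h) \<le> 2 * B" if h: "h \<in> schwartz_space" "schwartz_norm N h < r" for j h
    proof -
      have xh: "(\<lambda>t. x t + h t) \<in> schwartz_space" by (intro schwartz_space_add x h)
      have "T j h = T j (\<lambda>t. x t + h t) - T j x"
        using algebraic_dual_diff[OF lin xh x] by simp
      moreover have "norm (T j (\<lambda>t. x t + h t)) \<le> B"
        using B[OF xh] h by simp
      moreover have "norm (T j x) \<le> B"
        using B[OF x] r by simp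
      ultimately show ?thesis
        by (smt (verit) norm_triangle_ineq4)
    qed
    then have "norm (T j f) \<le> 2 * B / r * schwartz_norm N f" if "f \<in> schwartz_space" for j f
      using bound_from_ball[OF lin r _ that] by blast
    with unbounded show False by blast
  qed
  \<comment> \<open>A triple consists of the centre, the index of the seminorm and the radius of a ball.\<close>
  define Ball where "Ball = (\<lambda>(x :: real^'n \<Rightarrow> 'k, N, r).
    {y \<in> schwartz_space. schwartz_norm N (\<lambda>t. y t - x t) \<le> r})"
  define P where "P n s \<longleftrightarrow> (case s of (x :: real^'n \<Rightarrow> 'k, N, r) \<Rightarrow>
    x \<in> schwartz_space \<and> n \<le> N \<and> 0 < r \<and> r \<le> 1 / real (Suc n))" for n s
  define Q where "Q n s s' \<longleftrightarrow> Ball s' \<subseteq> Ball s \<and> (\<exists>j. \<forall>y\<in>Ball s'. real n < norm (T j y))"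
    for n :: nat and s s'
  have "\<exists>s. \<forall>n. P n (s n) \<and> Q n (s n) (s (Suc n))"
  proof (rule dependent_nat_choice)
    show "\<exists>s. P 0 s"
      unfolding P_def by (rule exI[of _ "(\<lambda>x. 0, 0, 1)"]) (simp add: zero_in_schwartz_space)
  next
    fix s n assume "P n s"
    then obtain x N r where s: "s = (x, N, r)" and x: "x \<in> schwartz_space" and r: "0 < r"
      unfolding P_def by (cases s) auto
    from large[OF x, of "r / 2" N "real n"] r obtain y j where y: "y \<in> schwartz_space"
      and yx: "schwartz_norm N (\<lambda>t. y t - x t) < r / 2" and big: "real n < norm (T j y)"
      by auto
    obtain C M where CM: "\<forall>f\<in>schwartz_space. norm (T j f) \<le> C * schwartz_norm M f"
      using bdd by blast
    define N' where "N' = max (Suc n) (max N M)"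
    \<comment> \<open>On a ball of radius \<open>d\<close>, the functional \<open>T j\<close> varies by less than \<open>norm (T j y) - n\<close>.\<close>
    define d where "d = (norm (T j y) - real n) / (2 * (\<bar>C\<bar> + 1))"
    define r' where "r' = min d (min (r / 2) (1 / real (Suc (Suc n))))"
    have "0 < d" using big by (simp add: d_def)
    then have r': "0 < r'" using r by (simp add: r'_def)
    have Cr: "\<bar>C\<bar> * r' < norm (T j y) - real n"
    proof -
      have "\<bar>C\<bar> * r' \<le> (\<bar>C\<bar> + 1) * d"
        using r' by (intro mult_mono) (auto simp: r'_def)
      also have "\<dots> = (norm (T j y) - real n) / 2"
        by (simp add: d_def field_simps)
      finally show ?thesis using big by simp
    qed
    have "z \<in> Ball s \<and> real n < norm (T j z)" if "z \<in> Ball (y, N', r')" for z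
    proof -
      have z: "z \<in> schwartz_space" and zy: "schwartz_norm N' (\<lambda>t. z t - y t) \<le> r'"
        using that by (auto simp: Ball_def)
      note zyS = schwartz_space_diff[OF z y]
      have "schwartz_norm N (\<lambda>t. z t - x t)
          \<le> schwartz_norm N (\<lambda>t. z t - y t) + schwartz_norm N (\<lambda>t. y t - x t)"
        by (rule schwartz_norm_triangle[OF z y x])
      also have "\<dots> \<le> r / 2 + r / 2"
      proof (rule add_mono)
        have "schwartz_norm N (\<lambda>t. z t - y t) \<le> schwartz_norm N' (\<lambda>t. z t - y t)"
          by (rule schwartz_norm_mono[OF zyS]) (simp add: N'_def)
        also have "\<dots> \<le> r / 2"
          using zy by (simp add: r'_def)
        finally show "schwartz_norm N (\<lambda>t. z t - y t) \<le> r / 2" .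
      qed (use yx in simp)
      finally have "z \<in> Ball s"
        using z by (simp add: Ball_def s)
      moreover have "norm (T j (\<lambda>t. z t - y t)) \<le> \<bar>C\<bar> * r'"
      proof -
        have "norm (T j (\<lambda>t. z t - y t)) \<le> C * schwartz_norm M (\<lambda>t. z t - y t)"
          using CM zyS by blast
        also have "\<dots> \<le> \<bar>C\<bar> * r'"
        proof (rule mult_mono)
          have "schwartz_norm M (\<lambda>t. z t - y t) \<le> schwartz_norm N' (\<lambda>t. z t - y t)"
            by (rule schwartz_norm_mono[OF zyS]) (simp add: N'_def)
          with zy show "schwartz_norm M (\<lambda>t. z t - y t) \<le> r'" by linarith
        qed (auto intro: schwartz_norm_nonneg zyS)
        finally show ?thesis .
      qed
      then have "norm (T j z - T j y) \<le> \<bar>C\<bar> * r'"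
        by (simp add: algebraic_dual_diff[OF lin z y])
      with Cr have "real n < norm (T j z)"
        by (smt (verit) norm_triangle_ineq3)
      ultimately show ?thesis by blast
    qed
    then have "Q n s (y, N', r')" unfolding Q_def by blast
    moreover have "P (Suc n) (y, N', r')"
      using y r' by (simp add: P_def N'_def r'_def)
    ultimately show "\<exists>s'. P (Suc n) s' \<and> Q n s s'" by blast
  qed
  then obtain s where P: "\<And>n. P n (s n)" and Q: "\<And>n. Q n (s n) (s (Suc n))"
    by blast
  define x where "x n = fst (s n)" for n
  define N where "N n = fst (snd (s n))" for n
  define r where "r n = snd (snd (s n))" for n
  have s: "s n = (x n, N n, r n)" for n by (simp add: x_def N_def r_def)
  have x: "x n \<in> schwartz_space" and N: "n \<le> N n" and r: "0 < r n" "r n \<le> 1 / real (Suc n)" for n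
    using P[of n] by (auto simp: P_def s)
  have "decseq (\<lambda>n. Ball (s n))"
    unfolding decseq_Suc_iff using Q by (auto simp: Q_def)
  moreover have "x n \<in> Ball (s n)" for n
    using x[of n] r(1)[of n] by (simp add: s Ball_def)
  ultimately have "x m \<in> Ball (s n)" if "n \<le> m" for m n
    using that by (auto simp: decseq_def)
  then have near: "schwartz_norm (N n) (\<lambda>t. x m t - x n t) \<le> r n" if "n \<le> m" for m n
    using that by (simp add: Ball_def s)
  have "\<exists>y\<in>schwartz_space. \<forall>k is. (\<lambda>j. schwartz_seminorm k is (\<lambda>t. x j t - y t)) \<longlonglongrightarrow> 0"
  proof (rule schwartz_space_complete[OF x])
    fix k and "is" :: "'n list" and e :: real assume "0 < e"
    obtain n0 where n0: "2 / e < real n0" using reals_Archimedean2 by blast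
    define n where "n = max n0 (max k (length is))"
    have "2 / e < real (Suc n)" using n0 by (simp add: n_def)
    have "1 / real (Suc n) < e / 2"
      using \<open>2 / e < real (Suc n)\<close> \<open>0 < e\<close> by (simp add: field_simps)
    then have rn: "r n + r n < e"
      using r(2)[of n] by linarith
    have le: "schwartz_seminorm k is (\<lambda>t. x a t - x n t) \<le> r n" if "n \<le> a" for a
    proof -
      have "schwartz_seminorm k is (\<lambda>t. x a t - x n t) \<le> schwartz_norm (N n) (\<lambda>t. x a t - x n t)"
        using N[of n] by (intro schwartz_seminorm_le_norm schwartz_space_diff x) (auto simp: n_def)
      then show ?thesis using near[OF that] by linarith
    qed
    have "schwartz_seminorm k is (\<lambda>t. x a t - x b t) < e" if "n \<le> a" "n \<le> b" for a b
    proof -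
      have "schwartz_seminorm k is (\<lambda>t. x a t - x b t) =
          schwartz_seminorm k is (\<lambda>t. 1 * (x a t - x n t) + (-1) * (x b t - x n t))"
        by simp
      also have "\<dots> \<le> norm (1::'k) * schwartz_seminorm k is (\<lambda>t. x a t - x n t) +
          norm (-1::'k) * schwartz_seminorm k is (\<lambda>t. x b t - x n t)"
        by (intro schwartz_seminorm_combination schwartz_space_diff x)
      also have "\<dots> < e" using le[OF that(1)] le[OF that(2)] rn by simp
      finally show ?thesis .
    qed
    then show "\<exists>M. \<forall>a\<ge>M. \<forall>b\<ge>M. schwartz_seminorm k is (\<lambda>t. x a t - x b t) < e" by blast
  qed
  then obtain y where y: "y \<in> schwartz_space"
    and lim: "\<And>k is. (\<lambda>j. schwartz_seminorm k is (\<lambda>t. x j t - y t)) \<longlonglongrightarrow> 0" by blast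
  \<comment> \<open>The balls are closed under limits, so the limit of the centres lies in all of them.\<close>
  have "y \<in> Ball (s n)" for n
  proof -
    have "schwartz_norm (N n) (\<lambda>t. y t - x n t) \<le> r n + schwartz_norm (N n) (\<lambda>t. x m t - y t)"
      if "n \<le> m" for m
    proof -
      have "schwartz_norm (N n) (\<lambda>t. y t - x n t) =
          schwartz_norm (N n) (\<lambda>t. 1 * (x m t - x n t) + (-1) * (x m t - y t))"
        by simp
      also have "\<dots> \<le> norm (1::'k) * schwartz_norm (N n) (\<lambda>t. x m t - x n t) +
          norm (-1::'k) * schwartz_norm (N n) (\<lambda>t. x m t - y t)"
        by (intro schwartz_norm_combination schwartz_space_diff x y)
      finally show ?thesis using near[OF that] by simp
    qed
    moreover have "(\<lambda>m. r n + schwartz_norm (N n) (\<lambda>t. x m t - y t)) \<longlonglongrightarrow> r n + 0"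
      unfolding schwartz_norm_def
      by (intro tendsto_add tendsto_const tendsto_null_sum lim)
    ultimately have "schwartz_norm (N n) (\<lambda>t. y t - x n t) \<le> r n + 0"
      by (intro LIMSEQ_le_const) blast+
    then show ?thesis using y by (simp add: Ball_def s)
  qed
  then have "\<exists>j. real n < norm (T j y)" for n
    using Q[of n] unfolding Q_def by blast
  moreover obtain B where "\<And>j. norm (T j y) \<le> B"
    using pw[OF y] by blast
  moreover obtain n where "B < real n"
    using reals_Archimedean2 by blast
  ultimately show False
    by (meson less_le_trans less_asym not_le)
qed


section \<open>Continuity of the operator generated by a Schwartz family\<close>

lemma family_operator_combination:
  fixes v :: "real^'m::finite \<Rightarrow> (real^'n::finite \<Rightarrow> 'k::{real_normed_field,euclidean_space}) \<Rightarrow> 'k"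
  assumes v: "schwartz_family v" and "f \<in> schwartz_space" "g \<in> schwartz_space"
  shows "family_operator v (\<lambda>x. c * f x + d * g x) =
    (\<lambda>p. c * family_operator v f p + d * family_operator v g p)"
  using schwartz_family_linear_operator[OF v] assms(2,3)
    schwartz_space_scale[OF assms(2), of c] schwartz_space_scale[OF assms(3), of d]
  unfolding schwartz_linear_operator_def by auto

lemma iter_partial_deriv_family_in_dual:
  fixes v :: "real^'m::finite \<Rightarrow> (real^'n::finite \<Rightarrow> 'k::{real_normed_field,euclidean_space}) \<Rightarrow> 'k"
  assumes v: "schwartz_family v"
  shows "(\<lambda>\<phi>. w * iter_partial_deriv is (family_operator v \<phi>) p) \<in> schwartz_algebraic_dual"
proof -
  have *: "iter_partial_deriv is (family_operator v (\<lambda>x. c * f x + d * g x)) p =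
      c * iter_partial_deriv is (family_operator v f) p + d * iter_partial_deriv is (family_operator v g) p"
    if "f \<in> schwartz_space" "g \<in> schwartz_space" for c d f g
  proof -
    have "smooth (family_operator v f)" "smooth (family_operator v g)"
      using v that by (auto simp: schwartz_family_def schwartz_space_def)
    then show ?thesis
      by (simp add: family_operator_combination[OF v that] iter_partial_deriv_combination)
  qed
  have "iter_partial_deriv is (family_operator v (\<lambda>x. f x + g x)) p =
      iter_partial_deriv is (family_operator v f) p + iter_partial_deriv is (family_operator v g) p"
    if "f \<in> schwartz_space" "g \<in> schwartz_space" for f g
    using *[OF that, of 1 1] by simp
  moreover have "iter_partial_deriv is (family_operator v (\<lambda>x. c * f x)) p =
      c * iter_partial_deriv is (family_operator v f) p" if "f \<in> schwartz_space" for c f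
    using *[OF that that, of c 0] by simp
  ultimately show ?thesis
    by (simp add: schwartz_algebraic_dual_def algebra_simps)
qed

text \<open>
  Induction over the directions: a further derivative at \<open>p\<close> is the pointwise limit of the
  difference quotients with step \<open>1 / (j + 1)\<close>. Each quotient involves only two points, where the
  induction hypothesis bounds it; convergence gives pointwise boundedness in \<open>j\<close>, so uniform
  boundedness yields one bound for all \<open>j\<close>, which the limit inherits.
\<close>

lemma iter_partial_deriv_family_bound:
  fixes v :: "real^'m::finite \<Rightarrow> (real^'n::finite \<Rightarrow> 'k::{real_normed_field,euclidean_space}) \<Rightarrow> 'k"
  assumes v: "schwartz_family v"
  shows "\<exists>C N. \<forall>\<phi>\<in>schwartz_space.
    norm (iter_partial_deriv is (family_operator v \<phi>) p) \<le> C * schwartz_norm N \<phi>"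
proof (induction "is" arbitrary: p)
  case Nil
  have "v p \<in> tempered_distributions" using v by (simp add: schwartz_family_def)
  from tempered_distribution_bound[OF this] show ?case
    by (simp add: family_operator_def)
next
  case (Cons i "is")
  define D where "D q \<phi> = iter_partial_deriv is (family_operator v \<phi>) q" for q \<phi>
  define h where "h j = inverse (real (Suc j))" for j
  define T where "T j \<phi> = (D (p + h j *\<^sub>R axis i 1) \<phi> - D p \<phi>) /\<^sub>R h j" for j \<phi>
  have lim: "(\<lambda>j. T j \<phi>) \<longlonglongrightarrow> iter_partial_deriv (i # is) (family_operator v \<phi>) p"
    if "\<phi> \<in> schwartz_space" for \<phi>
  proof -
    have "iter_partial_deriv is (family_operator v \<phi>) differentiable (at p)"
      using v that by (auto simp: schwartz_family_def schwartz_space_def smooth_def)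
    from partial_deriv_quotient_tendsto[OF this, of h i] show ?thesis
      using LIMSEQ_inverse_real_of_nat by (simp add: T_def D_def h_def[abs_def])
  qed
  have "\<exists>C N. \<forall>j. \<forall>\<phi>\<in>schwartz_space. norm (T j \<phi>) \<le> C * schwartz_norm N \<phi>"
  proof (rule schwartz_uniform_boundedness)
    fix j
    have "D q \<in> schwartz_algebraic_dual" for q
      using iter_partial_deriv_family_in_dual[OF v, of 1 "is" q] by (simp add: D_def[abs_def])
    then show "T j \<in> schwartz_algebraic_dual"
      by (simp add: schwartz_algebraic_dual_def T_def algebra_simps)
    obtain C M where C: "\<forall>\<phi>\<in>schwartz_space. norm (D (p + h j *\<^sub>R axis i 1) \<phi>) \<le> C * schwartz_norm M \<phi>"
      using Cons.IH unfolding D_def by blast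
    obtain C' M' where C': "\<forall>\<phi>\<in>schwartz_space. norm (D p \<phi>) \<le> C' * schwartz_norm M' \<phi>"
      using Cons.IH unfolding D_def by blast
    have h: "0 < h j" by (simp add: h_def)
    have "norm (T j \<phi>) \<le> (\<bar>C\<bar> + \<bar>C'\<bar>) / h j * schwartz_norm (max M M') \<phi>"
      if \<phi>: "\<phi> \<in> schwartz_space" for \<phi>
    proof -
      have *: "c * schwartz_norm L \<phi> \<le> \<bar>c\<bar> * schwartz_norm (max M M') \<phi>" if "L \<le> max M M'" for c L
        using that schwartz_norm_nonneg[OF \<phi>] by (intro mult_mono schwartz_norm_mono \<phi>) auto
      have "norm (D (p + h j *\<^sub>R axis i 1) \<phi> - D p \<phi>) \<le> C * schwartz_norm M \<phi> + C' * schwartz_norm M' \<phi>"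
        using C C' \<phi> by (intro norm_triangle_le_diff add_mono) auto
      also have "\<dots> \<le> (\<bar>C\<bar> + \<bar>C'\<bar>) * schwartz_norm (max M M') \<phi>"
        unfolding distrib_right by (intro add_mono *) auto
      finally show ?thesis
        using h by (simp add: T_def pos_le_divide_eq divide_inverse_commute[symmetric])
    qed
    then show "\<exists>C N. \<forall>\<phi>\<in>schwartz_space. norm (T j \<phi>) \<le> C * schwartz_norm N \<phi>" by blast
  next
    fix \<phi> :: "real^'n \<Rightarrow> 'k" assume "\<phi> \<in> schwartz_space"
    from lim[OF this] have "Bseq (\<lambda>j. T j \<phi>)"
      by (intro convergent_imp_Bseq convergentI)
    then show "\<exists>B. \<forall>j. norm (T j \<phi>) \<le> B" by (auto simp: Bseq_def)
  qed
  then obtain C N where "\<And>j \<phi>. \<phi> \<in> schwartz_space \<Longrightarrow> norm (T j \<phi>) \<le> C * schwartz_norm N \<phi>"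
    by blast
  then have "norm (iter_partial_deriv (i # is) (family_operator v \<phi>) p) \<le> C * schwartz_norm N \<phi>"
    if "\<phi> \<in> schwartz_space" for \<phi>
    using that by (intro LIMSEQ_le_const2[OF tendsto_norm[OF lim]]) auto
  then show ?case by blast
qed

text \<open>
  The weighted derivatives are now a family of bounded functionals indexed by the point \<open>p\<close>.
  Pointwise boundedness of this family is the rapid decrease of \<open>family_operator v \<phi>\<close>, and its
  uniform boundedness is the asserted seminorm estimate.
\<close>

lemma family_operator_seminorm_bound:
  fixes v :: "real^'m::finite \<Rightarrow> (real^'n::finite \<Rightarrow> 'k::{real_normed_field,euclidean_space}) \<Rightarrow> 'k"
  assumes v: "schwartz_family v"
  shows "\<exists>C N. \<forall>\<phi>\<in>schwartz_space.
    schwartz_seminorm k is (family_operator v \<phi>) \<le> C * schwartz_norm N \<phi>"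
proof -
  define w :: "real^'m \<Rightarrow> 'k" where "w p = of_real ((1 + norm p) ^ k)" for p
  have w: "norm (w p * z) = (1 + norm p) ^ k * norm z" for p z
    unfolding w_def norm_mult norm_of_real by simp
  have "\<exists>C N. \<forall>p. \<forall>\<phi>\<in>schwartz_space.
      norm (w p * iter_partial_deriv is (family_operator v \<phi>) p) \<le> C * schwartz_norm N \<phi>"
  proof (rule schwartz_uniform_boundedness)
    fix p
    obtain C N where C: "\<forall>\<phi>\<in>schwartz_space.
        norm (iter_partial_deriv is (family_operator v \<phi>) p) \<le> C * schwartz_norm N \<phi>"
      using iter_partial_deriv_family_bound[OF v] by blast
    have "norm (w p * iter_partial_deriv is (family_operator v \<phi>) p)
        \<le> ((1 + norm p) ^ k * C) * schwartz_norm N \<phi>" if "\<phi> \<in> schwartz_space" for \<phi>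
      unfolding w mult.assoc using C that by (intro mult_left_mono) auto
    then show "\<exists>C N. \<forall>\<phi>\<in>schwartz_space.
        norm (w p * iter_partial_deriv is (family_operator v \<phi>) p) \<le> C * schwartz_norm N \<phi>"
      by blast
  next
    fix \<phi> :: "real^'n \<Rightarrow> 'k" assume "\<phi> \<in> schwartz_space"
    then have "family_operator v \<phi> \<in> schwartz_space" using v by (simp add: schwartz_family_def)
    then show "\<exists>B. \<forall>p. norm (w p * iter_partial_deriv is (family_operator v \<phi>) p) \<le> B"
      unfolding w using schwartz_seminorm_upper by blast
  qed (rule iter_partial_deriv_family_in_dual[OF v])
  then obtain C N where "\<And>p \<phi>. \<phi> \<in> schwartz_space \<Longrightarrow>
      (1 + norm p) ^ k * norm (iter_partial_deriv is (family_operator v \<phi>) p) \<le> C * schwartz_norm N \<phi>"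
    unfolding w by blast
  then show ?thesis by (meson schwartz_seminorm_least)
qed

lemma family_operator_continuous:
  fixes v :: "real^'m::finite \<Rightarrow> (real^'n::finite \<Rightarrow> 'k::{real_normed_field,euclidean_space}) \<Rightarrow> 'k"
  assumes v: "schwartz_family v"
  shows "continuous_map schwartz_topology schwartz_topology (family_operator v)"
proof -
  let ?A = "family_operator v"
  let ?S = "{{f \<in> schwartz_space. schwartz_seminorm k is (\<lambda>x. f x - g x) < r} | k is g r.
        g \<in> (schwartz_space :: (real^'m \<Rightarrow> 'k) set) \<and> 0 < r}"
  have A: "?A \<phi> \<in> schwartz_space" if "\<phi> \<in> schwartz_space" for \<phi>
    using v that by (simp add: schwartz_family_def)
  have "openin schwartz_topology (?A -` U \<inter> topspace schwartz_topology)" if "U \<in> ?S" for U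
  proof (rule openin_schwartz_topologyI)
    from that obtain k "is" g r
      where U: "U = {f \<in> schwartz_space. schwartz_seminorm k is (\<lambda>x. f x - g x) < r}"
        and g: "g \<in> schwartz_space" by blast
    fix \<phi> assume "\<phi> \<in> ?A -` U \<inter> topspace schwartz_topology"
    then have \<phi>: "\<phi> \<in> schwartz_space" and less: "schwartz_seminorm k is (\<lambda>x. ?A \<phi> x - g x) < r"
      by (auto simp: U topspace_schwartz_topology)
    obtain C N where C: "\<forall>\<phi>\<in>schwartz_space. schwartz_seminorm k is (?A \<phi>) \<le> C * schwartz_norm N \<phi>"
      using family_operator_seminorm_bound[OF v] by blast
    let ?d = "(r - schwartz_seminorm k is (\<lambda>x. ?A \<phi> x - g x)) / (\<bar>C\<bar> + 1)"
    have "schwartz_seminorm k is (\<lambda>x. ?A \<psi> x - g x) < r"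
      if \<psi>: "\<psi> \<in> schwartz_space" and near: "schwartz_norm N (\<lambda>x. \<psi> x - \<phi> x) < ?d" for \<psi>
    proof -
      note diff = schwartz_space_diff[OF \<psi> \<phi>]
      have "?A (\<lambda>x. \<psi> x - \<phi> x) = (\<lambda>x. ?A \<psi> x - ?A \<phi> x)"
        using family_operator_combination[OF v \<psi> \<phi>, of 1 "-1"] by simp
      then have "schwartz_seminorm k is (\<lambda>x. ?A \<psi> x - ?A \<phi> x) \<le> C * schwartz_norm N (\<lambda>x. \<psi> x - \<phi> x)"
        using C diff by force
      also have "\<dots> \<le> (\<bar>C\<bar> + 1) * schwartz_norm N (\<lambda>x. \<psi> x - \<phi> x)"
        using schwartz_norm_nonneg[OF diff] by (intro mult_right_mono) auto
      also have "\<dots> < r - schwartz_seminorm k is (\<lambda>x. ?A \<phi> x - g x)"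
        using near by (simp add: pos_less_divide_eq mult.commute)
      finally show ?thesis
        using schwartz_seminorm_triangle[OF A[OF \<psi>] A[OF \<phi>] g, of k "is"] by linarith
    qed
    then have "{\<psi> \<in> schwartz_space. schwartz_norm N (\<lambda>x. \<psi> x - \<phi> x) < ?d}
        \<subseteq> ?A -` U \<inter> topspace schwartz_topology"
      using A by (auto simp: U topspace_schwartz_topology)
    moreover have "0 < ?d" using less by simp
    ultimately show "\<exists>N d. 0 < d \<and> {\<psi> \<in> schwartz_space. schwartz_norm N (\<lambda>x. \<psi> x - \<phi> x) < d}
        \<subseteq> ?A -` U \<inter> topspace schwartz_topology" by blast
  qed (simp add: topspace_schwartz_topology)
  moreover have "\<Union>?S = schwartz_space"
    by (rule trans[OF topology_generated_by_topspace[symmetric]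
          topspace_schwartz_topology[unfolded schwartz_topology_def]])
  then have "?A ` topspace schwartz_topology \<subseteq> \<Union>?S"
    using A by (simp only: topspace_schwartz_topology image_subset_iff) blast
  ultimately show ?thesis
    unfolding schwartz_topology_def[where 'n='m]
    by (rule continuous_on_generated_topo)
qed

lemma continuous_imp_transposable:
  assumes A: "schwartz_linear_operator A" and cont: "continuous_map schwartz_topology schwartz_topology A"
  shows "transposable A"
proof -
  have "a \<circ> A \<in> tempered_distributions" if "a \<in> tempered_distributions" for a
  proof -
    have "a \<circ> A \<in> schwartz_algebraic_dual"
      using A that by (auto simp: schwartz_linear_operator_def tempered_distributions_def
          schwartz_algebraic_dual_def image_subset_iff)
    moreover have "continuous_map schwartz_topology euclidean (a \<circ> A)"
      using that by (intro continuous_map_compose[OF cont]) (simp add: tempered_distributions_def)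
    ultimately show ?thesis by (simp add: tempered_distributions_def)
  qed
  with A show ?thesis by (auto simp: transposable_def algebraic_transpose_def)
qed

lemma transposable_imp_weakly_continuous:
  fixes A :: "(real^'n::finite \<Rightarrow> 'k) \<Rightarrow> (real^'m::finite \<Rightarrow> 'k::{real_normed_field,euclidean_space})"
  assumes "transposable A"
  shows "continuous_map schwartz_weak_topology schwartz_weak_topology A"
proof -
  let ?S = "{{f \<in> (schwartz_space :: (real^'m \<Rightarrow> 'k) set). a f \<in> U} | a U.
    a \<in> tempered_distributions \<and> open U}"
  have A: "A f \<in> schwartz_space" if "f \<in> schwartz_space" for f
    using assms that by (auto simp: transposable_def schwartz_linear_operator_def)
  have "openin schwartz_weak_topology (A -` V \<inter> topspace schwartz_weak_topology)" if "V \<in> ?S" for V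
  proof -
    from that obtain a U where V: "V = {f \<in> schwartz_space. a f \<in> U}"
      and a: "a \<in> tempered_distributions" and U: "open U" by blast
    have "a \<circ> A \<in> tempered_distributions"
      using assms a by (auto simp: transposable_def algebraic_transpose_def)
    then have "openin schwartz_weak_topology {f \<in> schwartz_space. (a \<circ> A) f \<in> U}"
      unfolding weak_topology_def using U by (intro topology_generated_by_Basis) blast
    also have "{f \<in> schwartz_space. (a \<circ> A) f \<in> U} = A -` V \<inter> topspace schwartz_weak_topology"
      using A by (auto simp: V topspace_schwartz_weak_topology)
    finally show ?thesis .
  qed
  moreover have "\<Union>?S = schwartz_space"
    by (rule trans[OF topology_generated_by_topspace[symmetric]
          topspace_schwartz_weak_topology[unfolded weak_topology_def]])
  then have "A ` topspace schwartz_weak_topology \<subseteq> \<Union>?S"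
    using A by (simp only: topspace_schwartz_weak_topology image_subset_iff) blast
  ultimately show ?thesis
    unfolding weak_topology_def[where 'e="real^'m \<Rightarrow> 'k"]
    by (rule continuous_on_generated_topo)
qed

theorem mainTheorem1:
  fixes v :: "real^'m::finite \<Rightarrow> (real^'n::finite \<Rightarrow> 'k::{real_normed_field,euclidean_space}) \<Rightarrow> 'k"
  assumes "schwartz_family v"
  shows
    "((\<forall>a\<in>tempered_distributions. summable_wrt v a) \<and>
      transposable (family_operator v) \<and>
      continuous_map schwartz_weak_topology schwartz_weak_topology (family_operator v) \<and>
      continuous_map schwartz_topology schwartz_topology (family_operator v)) \<and>
     ((\<forall>a\<in>tempered_distributions. summable_wrt v a) \<longleftrightarrow>
        transposable (family_operator v)) \<and>
     (transposable (family_operator v) \<longleftrightarrow>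
        continuous_map schwartz_weak_topology schwartz_weak_topology (family_operator v)) \<and>
     (continuous_map schwartz_weak_topology schwartz_weak_topology (family_operator v) \<longleftrightarrow>
        continuous_map schwartz_topology schwartz_topology (family_operator v))"
proof -
  have cont: "continuous_map schwartz_topology schwartz_topology (family_operator v)"
    by (rule family_operator_continuous[OF assms])
  have trans: "transposable (family_operator v)"
    by (rule continuous_imp_transposable[OF schwartz_family_linear_operator[OF assms] cont])
  have weak: "continuous_map schwartz_weak_topology schwartz_weak_topology (family_operator v)"
    by (rule transposable_imp_weakly_continuous[OF trans])
  have "\<forall>a\<in>tempered_distributions. summable_wrt v a"
    using trans by (auto simp: transposable_def algebraic_transpose_def summable_wrt_def)
  with cont trans weak show ?thesis by blast
qed

end
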